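(* Let $A$ be a Banach algebra and $J$ a closed two-sided ideal of $A$. Suppose $\kappa_r,\kappa_\ell>0$ satisfy, for all $a\in A$, $$\kappa_r\|a\|\le\sup_{x\in B_J}\|ax\|,\qquad \kappa_\ell\|a\|\le\sup_{x\in B_J}\|xa\|.$$ Then for every $n\ge1$ and every $a\in A$, $$\kappa_r^n\|a\|\le\sup_{x\in B_{J^{[n]}}}\|ax\|\le\|a\|,\qquad \kappa_\ell^n\|a\|\le\sup_{x\in B_{J^{[n]}}}\|xa\|\le\|a\|.$$ In particular, every $J^{[n]}$ is essential on both sides, and left multiplication $a\mapsto(x\mapsto ax)$ represents $A$ (injectively) as a closed subalgebra of $\mathcal B(J^{[n]})$; right multiplication $a\mapsto(x\mapsto xa)$ gives the analogous representation of the opposite algebra $A^{\mathrm{op}}$. Moreover, let $n\ge 1$, let $B$ be a Banach algebra, and let $\Phi:A\to B$ be a bounded homomorphism satisfying, for some $\eta>0$, $\|\Phi(x)\|\ge\eta\|x\|$ for all $x\in J^{[n]}$. If $A\ne\{0\}$, then $$\|\Phi(a)\|\ge\frac{\eta\kappa_r^n}{\|\Phi\|}\,\|a\|\qquad\text{for all }a\in A.$$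
   Context: Banach algebras are complex with submultiplicative norm. For a closed two-sided ideal $J$ of $A$ and $n\ge1$, $J^{[n]}=\overline{\operatorname{span}}\{x_1\cdots x_n:x_i\in J\}$ (norm closure of the linear span). For such an ideal, $B_J$ (respectively $B_{J^{[n]}}$) is its closed unit ball in the norm inherited from $A$. $\mathcal B(E)$ is the algebra of bounded operators on a Banach space $E$. "Essential on both sides" means that every nonzero right ideal of $A$ and every nonzero left ideal of $A$ has nonzero intersection with $J^{[n]}$. *)

theory Defs
  imports "HOL-Analysis.Analysis"
begin

section \<open>Complex Banach algebras\<close>

class complex_vector = real_vector +
  fixes scaleC :: "complex \<Rightarrow> 'a \<Rightarrow> 'a" (infixr "*\<^sub>C" 75)
  assumes scaleC_add_right: "c *\<^sub>C (x + y) = c *\<^sub>C x + c *\<^sub>C y"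
    and scaleC_add_left: "(c + d) *\<^sub>C x = c *\<^sub>C x + d *\<^sub>C x"
    and scaleC_scaleC: "c *\<^sub>C (d *\<^sub>C x) = (c * d) *\<^sub>C x"
    and scaleC_one: "1 *\<^sub>C x = x"
    and scaleR_scaleC: "r *\<^sub>R x = complex_of_real r *\<^sub>C x"

global_interpretation complex_vector:
  vector_space "scaleC :: complex \<Rightarrow> 'a \<Rightarrow> 'a::complex_vector"
  defines csubspace = complex_vector.subspace
    and cspan = complex_vector.span
  by unfold_locales
    (simp_all add: scaleC_add_right scaleC_add_left scaleC_scaleC scaleC_one)

text \<open>No unit is required: \<^class>\<open>real_normed_algebra\<close> is the non-unital class and
  contributes submultiplicativity of the norm.\<close>

class complex_banach_algebra = complex_vector + real_normed_algebra + banach +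
  assumes norm_scaleC: "norm (c *\<^sub>C x) = cmod c * norm x"
    and mult_scaleC_left: "(c *\<^sub>C x) * y = c *\<^sub>C (x * y)"
    and mult_scaleC_right: "x * (c *\<^sub>C y) = c *\<^sub>C (x * y)"

definition bounded_algebra_hom ::
    "('a::complex_banach_algebra \<Rightarrow> 'b::complex_banach_algebra) \<Rightarrow> bool" where
  "bounded_algebra_hom \<Phi> \<longleftrightarrow>
     bounded_linear \<Phi> \<and> Vector_Spaces.linear (*\<^sub>C) (*\<^sub>C) \<Phi> \<and> (\<forall>a b. \<Phi> (a * b) = \<Phi> a * \<Phi> b)"

section \<open>Ideals and their powers\<close>

definition left_ideal :: "'a::complex_banach_algebra set \<Rightarrow> bool" where
  "left_ideal I \<longleftrightarrow> csubspace I \<and> (\<forall>a. \<forall>x\<in>I. a * x \<in> I)"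

definition right_ideal :: "'a::complex_banach_algebra set \<Rightarrow> bool" where
  "right_ideal I \<longleftrightarrow> csubspace I \<and> (\<forall>a. \<forall>x\<in>I. x * a \<in> I)"

definition closed_two_sided_ideal :: "'a::complex_banach_algebra set \<Rightarrow> bool" where
  "closed_two_sided_ideal J \<longleftrightarrow> left_ideal J \<and> right_ideal J \<and> closed J"

text \<open>Since there need not be a unit, an \<open>n\<close>-fold product \<open>x\<^sub>1 \<cdots> x\<^sub>n\<close> is written
  as a fold over a nonempty list; the notion is meant for \<open>n \<ge> 1\<close> only.\<close>

definition ideal_power :: "'a::complex_banach_algebra set \<Rightarrow> nat \<Rightarrow> 'a set" where
  "ideal_power J n =
     closure (cspan {foldl (*) x xs | x xs. set (x # xs) \<subseteq> J \<and> length (x # xs) = n})"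

definition unit_ball :: "'a::real_normed_vector set \<Rightarrow> 'a set" where
  "unit_ball E = {x \<in> E. norm x \<le> 1}"

definition essential_on_both_sides :: "'a::complex_banach_algebra set \<Rightarrow> bool" where
  "essential_on_both_sides K \<longleftrightarrow>
     (\<forall>I. right_ideal I \<and> I \<noteq> {0} \<longrightarrow> I \<inter> K \<noteq> {0}) \<and>
     (\<forall>I. left_ideal I \<and> I \<noteq> {0} \<longrightarrow> I \<inter> K \<noteq> {0})"

section \<open>Bounded operators on a closed subspace\<close>

text \<open>The Banach space \<open>E\<close> is a subspace of the ambient type, so an operator on \<open>E\<close> is
  a function on that type whose values outside \<open>E\<close> are fixed by \<^const>\<open>extensional\<close>;
  this makes equality of functions coincide with equality of operators on \<open>E\<close>.
  Composition is \<^const>\<open>compose\<close>.\<close>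

definition bounded_ops :: "'a::complex_banach_algebra set \<Rightarrow> ('a \<Rightarrow> 'a) set" where
  "bounded_ops E = {T. T \<in> extensional E \<and> T ` E \<subseteq> E \<and>
     (\<forall>x\<in>E. \<forall>y\<in>E. T (x + y) = T x + T y) \<and>
     (\<forall>c. \<forall>x\<in>E. T (c *\<^sub>C x) = c *\<^sub>C T x) \<and>
     (\<exists>K. \<forall>x\<in>E. norm (T x) \<le> K * norm x)}"

definition op_add :: "'a::complex_banach_algebra set \<Rightarrow> ('a \<Rightarrow> 'a) \<Rightarrow> ('a \<Rightarrow> 'a) \<Rightarrow> 'a \<Rightarrow> 'a" where
  "op_add E S T = (\<lambda>x\<in>E. S x + T x)"

definition op_scale :: "'a::complex_banach_algebra set \<Rightarrow> complex \<Rightarrow> ('a \<Rightarrow> 'a) \<Rightarrow> 'a \<Rightarrow> 'a" where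
  "op_scale E c T = (\<lambda>x\<in>E. c *\<^sub>C T x)"

text \<open>The value \<open>0\<close> off \<^const>\<open>bounded_ops\<close> is irrelevant; it is there because
  \<^locale>\<open>Metric_space\<close> demands a distance that is nonnegative on the whole type.\<close>

definition op_norm :: "'a::complex_banach_algebra set \<Rightarrow> ('a \<Rightarrow> 'a) \<Rightarrow> real" where
  "op_norm E T = (if T \<in> bounded_ops E then SUP x\<in>unit_ball E. norm (T x) else 0)"

definition op_dist :: "'a::complex_banach_algebra set \<Rightarrow> ('a \<Rightarrow> 'a) \<Rightarrow> ('a \<Rightarrow> 'a) \<Rightarrow> real" where
  "op_dist E S T = op_norm E (\<lambda>x\<in>E. S x - T x)"

definition closed_subalgebra_ops ::
    "'a::complex_banach_algebra set \<Rightarrow> ('a \<Rightarrow> 'a) set \<Rightarrow> bool" where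
  "closed_subalgebra_ops E \<A> \<longleftrightarrow>
     \<A> \<subseteq> bounded_ops E \<and> (\<lambda>x\<in>E. 0) \<in> \<A> \<and>
     (\<forall>S\<in>\<A>. \<forall>T\<in>\<A>. op_add E S T \<in> \<A>) \<and>
     (\<forall>c. \<forall>T\<in>\<A>. op_scale E c T \<in> \<A>) \<and>
     (\<forall>S\<in>\<A>. \<forall>T\<in>\<A>. compose E S T \<in> \<A>) \<and>
     closedin (Metric_space.mtopology (bounded_ops E) (op_dist E)) \<A>"

text \<open>The product of the represented algebra is a parameter, because the opposite algebra
  is the same Banach space with the product \<open>\<lambda>a b. b * a\<close>.\<close>

definition bounded_representation ::
    "('a \<Rightarrow> 'a \<Rightarrow> 'a) \<Rightarrow> 'a::complex_banach_algebra set \<Rightarrow> ('a \<Rightarrow> 'a \<Rightarrow> 'a) \<Rightarrow> bool" where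
  "bounded_representation m E \<pi> \<longleftrightarrow>
     range \<pi> \<subseteq> bounded_ops E \<and>
     (\<forall>a b. \<pi> (a + b) = op_add E (\<pi> a) (\<pi> b)) \<and>
     (\<forall>c a. \<pi> (c *\<^sub>C a) = op_scale E c (\<pi> a)) \<and>
     (\<forall>a b. \<pi> (m a b) = compose E (\<pi> a) (\<pi> b)) \<and>
     (\<exists>K. \<forall>a. op_norm E (\<pi> a) \<le> K * norm a)"

definition represents_as_closed_subalgebra ::
    "('a \<Rightarrow> 'a \<Rightarrow> 'a) \<Rightarrow> 'a::complex_banach_algebra set \<Rightarrow> ('a \<Rightarrow> 'a \<Rightarrow> 'a) \<Rightarrow> bool" where
  "represents_as_closed_subalgebra m E \<pi> \<longleftrightarrow>
     bounded_representation m E \<pi> \<and> inj \<pi> \<and> closed_subalgebra_ops E (range \<pi>)"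

definition opposite_mult :: "'a::times \<Rightarrow> 'a \<Rightarrow> 'a" where
  "opposite_mult a b = b * a"

definition left_mult_on :: "'a::times set \<Rightarrow> 'a \<Rightarrow> 'a \<Rightarrow> 'a" where
  "left_mult_on E a = (\<lambda>x\<in>E. a * x)"

definition right_mult_on :: "'a::times set \<Rightarrow> 'a \<Rightarrow> 'a \<Rightarrow> 'a" where
  "right_mult_on E a = (\<lambda>x\<in>E. x * a)"

section \<open>The operator norm distance is a metric\<close>

lemma op_norm_bound:
  assumes E: "csubspace E" and T: "T \<in> bounded_ops E" and x: "x \<in> unit_ball E"
  shows "norm (T x) \<le> op_norm E T"
proof -
  obtain K where K: "\<forall>x\<in>E. norm (T x) \<le> K * norm x"
    using T by (auto simp: bounded_ops_def)
  have "norm (T y) \<le> \<bar>K\<bar>" if "y \<in> unit_ball E" for y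
  proof -
    have y: "y \<in> E" "norm y \<le> 1" using that by (auto simp: unit_ball_def)
    have "norm (T y) \<le> K * norm y" using K y by blast
    also have "\<dots> \<le> \<bar>K\<bar> * norm y" by (simp add: mult_right_mono)
    also have "\<dots> \<le> \<bar>K\<bar> * 1" using y by (intro mult_left_mono) auto
    finally show ?thesis by simp
  qed
  then have "bdd_above ((\<lambda>x. norm (T x)) ` unit_ball E)"
    by (intro bdd_aboveI2[of _ _ "\<bar>K\<bar>"])
  then show ?thesis
    using T x by (auto simp: op_norm_def intro: cSUP_upper)
qed

lemma zero_in_unit_ball: "csubspace E \<Longrightarrow> 0 \<in> unit_ball E"
  by (simp add: unit_ball_def complex_vector.subspace_0)

lemma op_norm_nonneg: "csubspace E \<Longrightarrow> 0 \<le> op_norm E T"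
  using op_norm_bound[of E T 0] zero_in_unit_ball[of E]
  by (cases "T \<in> bounded_ops E") (auto simp: op_norm_def intro: order_trans[OF norm_ge_zero])

lemma op_diff_in_bounded_ops:
  assumes E: "csubspace E" and "S \<in> bounded_ops E" "T \<in> bounded_ops E"
  shows "(\<lambda>x\<in>E. S x - T x) \<in> bounded_ops E"
proof -
  obtain K L where K: "\<forall>x\<in>E. norm (S x) \<le> K * norm x" and L: "\<forall>x\<in>E. norm (T x) \<le> L * norm x"
    using assms by (auto simp: bounded_ops_def)
  have "norm (S x - T x) \<le> (K + L) * norm x" if "x \<in> E" for x
    using norm_triangle_ineq4[of "S x" "T x"] K L that
    by (fastforce simp: distrib_right)
  then have "\<exists>M. \<forall>x\<in>E. norm ((\<lambda>x\<in>E. S x - T x) x) \<le> M * norm x" by auto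
  moreover have "\<forall>x\<in>E. \<forall>y\<in>E. x + y \<in> E" "\<forall>c. \<forall>x\<in>E. c *\<^sub>C x \<in> E" "\<forall>x\<in>E. \<forall>y\<in>E. x - y \<in> E"
    using E by (auto simp: complex_vector.subspace_add complex_vector.subspace_scale
        complex_vector.subspace_diff)
  ultimately show ?thesis
    using assms
    by (auto simp: bounded_ops_def image_subset_iff complex_vector.scale_right_diff_distrib)
qed

lemma op_ext_eqI:
  assumes E: "csubspace E" and S: "S \<in> bounded_ops E" and T: "T \<in> bounded_ops E"
    and eq: "\<And>x. x \<in> unit_ball E \<Longrightarrow> S x = T x"
  shows "S = T"
proof
  fix x
  show "S x = T x"
  proof (cases "x \<in> E \<and> x \<noteq> 0")
    case True
    define c where "c = complex_of_real (inverse (norm x))"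
    have c: "c \<noteq> 0" "c *\<^sub>C x \<in> unit_ball E"
      using True E by (auto simp: c_def unit_ball_def complex_vector.subspace_scale norm_scaleC
          norm_inverse)
    have "c *\<^sub>C S x = c *\<^sub>C T x"
      using eq[OF c(2)] S T True by (auto simp: bounded_ops_def)
    then show ?thesis using c(1) by simp
  next
    case False
    then show ?thesis
      using eq[OF zero_in_unit_ball[OF E]] S T by (auto simp: bounded_ops_def extensional_def)
  qed
qed

lemma Metric_space_bounded_ops:
  assumes E: "csubspace E"
  shows "Metric_space (bounded_ops E) (op_dist E)"
proof
  fix S T :: "'a \<Rightarrow> 'a"
  show "0 \<le> op_dist E S T" by (simp add: op_dist_def op_norm_nonneg E)
  have *: "(\<lambda>x\<in>E. T x - S x) \<in> bounded_ops E" if "(\<lambda>x\<in>E. S x - T x) \<in> bounded_ops E" for S T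
  proof -
    have Z: "(\<lambda>x\<in>E. 0) \<in> bounded_ops E"
      using E by (auto simp: bounded_ops_def complex_vector.subspace_0 complex_vector.subspace_add
            complex_vector.subspace_scale intro: exI[of _ 0])
    have "(\<lambda>x\<in>E. (\<lambda>x\<in>E. 0) x - (\<lambda>x\<in>E. S x - T x) x) = (\<lambda>x\<in>E. T x - S x)"
      by (auto simp: restrict_def)
    then show ?thesis using op_diff_in_bounded_ops[OF E Z that] by simp
  qed
  have "(SUP x\<in>unit_ball E. norm ((\<lambda>x\<in>E. S x - T x) x)) =
        (SUP x\<in>unit_ball E. norm ((\<lambda>x\<in>E. T x - S x) x))"
    by (intro arg_cong[where f = Sup] image_cong) (auto simp: unit_ball_def norm_minus_commute)
  then show "op_dist E S T = op_dist E T S"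
    using *[of S T] *[of T S] by (auto simp: op_dist_def op_norm_def)
next
  fix S T assume ST: "S \<in> bounded_ops E" "T \<in> bounded_ops E"
  let ?D = "\<lambda>x\<in>E. S x - T x"
  have D: "?D \<in> bounded_ops E" by (rule op_diff_in_bounded_ops[OF E ST])
  show "op_dist E S T = 0 \<longleftrightarrow> S = T"
  proof
    assume "op_dist E S T = 0"
    then have "norm (?D x) \<le> 0" if "x \<in> unit_ball E" for x
      using op_norm_bound[OF E D that] by (simp add: op_dist_def)
    then show "S = T"
      by (intro op_ext_eqI[OF E ST]) (auto simp: unit_ball_def)
  next
    assume "S = T"
    then have "(\<lambda>x. norm (?D x)) ` unit_ball E = {0}"
      using zero_in_unit_ball[OF E] by (auto simp: unit_ball_def image_iff)
    then show "op_dist E S T = 0" by (simp add: op_dist_def op_norm_def)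
  qed
next
  fix R S T assume RST: "R \<in> bounded_ops E" "S \<in> bounded_ops E" "T \<in> bounded_ops E"
  have RT: "(\<lambda>x\<in>E. R x - T x) \<in> bounded_ops E" and RS: "(\<lambda>x\<in>E. R x - S x) \<in> bounded_ops E"
    and ST: "(\<lambda>x\<in>E. S x - T x) \<in> bounded_ops E"
    using op_diff_in_bounded_ops[OF E] RST by blast+
  have "norm ((\<lambda>x\<in>E. R x - T x) x) \<le> op_dist E R S + op_dist E S T" if x: "x \<in> unit_ball E" for x
  proof -
    have "norm (R x - T x) \<le> norm (R x - S x) + norm (S x - T x)"
      by (rule norm_triangle_sub[of "R x - T x" "R x - S x", simplified, THEN order_trans])
         (simp add: algebra_simps)
    then show ?thesis
      using op_norm_bound[OF E RS x] op_norm_bound[OF E ST x] x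
      by (simp add: op_dist_def unit_ball_def)
  qed
  then have "(SUP x\<in>unit_ball E. norm ((\<lambda>x\<in>E. R x - T x) x)) \<le> op_dist E R S + op_dist E S T"
    using zero_in_unit_ball[OF E] by (intro cSUP_least) auto
  then show "op_dist E R T \<le> op_dist E R S + op_dist E S T"
    using RT by (simp add: op_dist_def op_norm_def)
qed

end

theory Submission
  imports Defs
begin

text \<open>For \<open>x\<close> in the unit ball of \<open>J\<close>, multiplication by \<open>x\<close> maps the unit ball of \<open>J\<^sup>[\<^sup>n\<^sup>]\<close> into
  that of \<open>J\<^sup>[\<^sup>n\<^sup>+\<^sup>1\<^sup>]\<close>, so \<open>\<kappa>\<^sup>n \<parallel>ax\<parallel>\<close> is at most the supremum for \<open>a\<close> over the latter; a supremum
  over \<open>x\<close> gains the next factor \<open>\<kappa>\<close>. Hence the multiplication representation on \<open>J\<^sup>[\<^sup>n\<^sup>]\<close> is bounded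
  below, and so has closed range. For the last part,
  \<open>\<eta> \<parallel>ax\<parallel> \<le> \<parallel>\<Phi>(ax)\<parallel> \<le> \<parallel>\<Phi>(a)\<parallel> \<parallel>\<Phi>\<parallel>\<close> for all \<open>x\<close> in the unit ball.\<close>

text \<open>Here \<open>m\<close> is the product of \<open>A\<close> or of its opposite algebra, so that right multiplication is an
  instance of left multiplication.\<close>

locale banach_product = bounded_bilinear m
  for m :: "'a::complex_banach_algebra \<Rightarrow> 'a \<Rightarrow> 'a" +
  assumes scaleC_left: "m (c *\<^sub>C x) y = c *\<^sub>C m x y"
    and scaleC_right: "m x (c *\<^sub>C y) = c *\<^sub>C m x y"
    and assoc: "m (m x y) z = m x (m y z)"
    and norm_product_le: "norm (m x y) \<le> norm x * norm y"
begin

section \<open>Multiplication operators on unit balls of subspaces\<close>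

lemma norm_unit_ball_le: "x \<in> unit_ball E \<Longrightarrow> norm (m a x) \<le> norm a"
  using norm_product_le[of a x] mult_left_mono[of "norm x" 1 "norm a"]
  by (auto simp: unit_ball_def)

lemma bdd_above_unit_ball: "bdd_above ((\<lambda>x. norm (m a x)) ` unit_ball E)"
  by (intro bdd_aboveI2[of _ _ "norm a"] norm_unit_ball_le)

lemma SUP_unit_ball_le:
  "csubspace E \<Longrightarrow> (SUP x\<in>unit_ball E. norm (m a x)) \<le> norm a"
  using zero_in_unit_ball[of E] by (intro cSUP_least norm_unit_ball_le) auto

lemma unit_ball_le_SUP:
  "x \<in> unit_ball E \<Longrightarrow> norm (m a x) \<le> (SUP x\<in>unit_ball E. norm (m a x))"
  by (intro cSUP_upper bdd_above_unit_ball)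

text \<open>\<open>P n\<close> stands for the n-th ideal power, so that \<open>P 1\<close> is J.
  Consecutive powers are linked only by prefixing one factor from \<open>P 1\<close>; under
  \<open>opposite_mult\<close> prefixing becomes appending, hence the abstract family.\<close>

lemma power_lower_bound:
  assumes sub: "\<And>n. csubspace (P n)"
    and prod: "\<And>n x y. n \<ge> 1 \<Longrightarrow> x \<in> P 1 \<Longrightarrow> y \<in> P n \<Longrightarrow> m x y \<in> P (Suc n)"
    and "\<kappa> > 0"
    and base: "\<And>a. \<kappa> * norm a \<le> (SUP x\<in>unit_ball (P 1). norm (m a x))"
    and "n \<ge> 1"
  shows "\<kappa> ^ n * norm a \<le> (SUP x\<in>unit_ball (P n). norm (m a x))"
  using \<open>n \<ge> 1\<close>
proof (induction n arbitrary: a rule: dec_induct)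
  case base
  then show ?case using assms(4) by simp
next
  case (step n)
  let ?S = "SUP z\<in>unit_ball (P (Suc n)). norm (m a z)"
  \<comment> \<open>The induction hypothesis is applied to the element \<open>m a x\<close>, which
    is why \<open>a\<close> is generalized. The resulting bound is uniform in
    \<open>x\<close>.\<close>
  have "norm (m a x) \<le> ?S / \<kappa> ^ n" if x: "x \<in> unit_ball (P 1)" for x
  proof -
    have "\<kappa> ^ n * norm (m a x) \<le> (SUP y\<in>unit_ball (P n). norm (m (m a x) y))"
      by (rule step.IH)
    also have "\<dots> \<le> ?S"
    proof (rule cSUP_least)
      show "unit_ball (P n) \<noteq> {}" using zero_in_unit_ball[OF sub] by blast
      fix y assume y: "y \<in> unit_ball (P n)"
      have "m x y \<in> unit_ball (P (Suc n))"
        using x y prod[OF step.hyps(1), of x y] norm_unit_ball_le[OF y, of x]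
        by (auto simp: unit_ball_def)
      then show "norm (m (m a x) y) \<le> ?S"
        unfolding assoc by (rule unit_ball_le_SUP)
    qed
    finally show ?thesis using \<open>\<kappa> > 0\<close> by (simp add: field_simps)
  qed
  then have "(SUP x\<in>unit_ball (P 1). norm (m a x)) \<le> ?S / \<kappa> ^ n"
    using zero_in_unit_ball[OF sub[of 1]] by (intro cSUP_least) auto
  then have "\<kappa> * norm a \<le> ?S / \<kappa> ^ n" using assms(4)[of a] by linarith
  then show ?case using \<open>\<kappa> > 0\<close> by (simp add: field_simps)
qed

text \<open>For a nonzero \<open>a\<close> in \<open>I\<close>, every product \<open>m a x\<close>
  with \<open>x\<close> in \<open>E\<close> lies in both \<open>I\<close> and \<open>E\<close>. A
  trivial intersection would make \<open>a\<close> annihilate \<open>E\<close>, against the lower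
  bound.\<close>

lemma essential_if_bounded_below:
  assumes E: "csubspace E" "\<And>a x. x \<in> E \<Longrightarrow> m a x \<in> E"
    and "\<kappa> > 0" and lower: "\<And>a. \<kappa> * norm a \<le> (SUP x\<in>unit_ball E. norm (m a x))"
    and I: "csubspace I" "\<And>a x. x \<in> I \<Longrightarrow> m x a \<in> I" "I \<noteq> {0}"
  shows "I \<inter> E \<noteq> {0}"
proof
  assume triv: "I \<inter> E = {0}"
  obtain a where a: "a \<in> I" "a \<noteq> 0"
    using I(3) complex_vector.subspace_0[OF I(1)] by blast
  have "m a x = 0" if "x \<in> unit_ball E" for x
    using E(2)[of x a] I(2)[OF a(1), of x] triv that by (auto simp: unit_ball_def)
  then have "(SUP x\<in>unit_ball E. norm (m a x)) \<le> 0"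
    using zero_in_unit_ball[OF E(1)] by (intro cSUP_least) auto
  moreover have "\<kappa> * norm a > 0" using a(2) \<open>\<kappa> > 0\<close> by simp
  ultimately show False using lower[of a] by linarith
qed

text \<open>The lower bound gives injectivity and pulls Cauchy sequences in the range back to Cauchy
  sequences in the complete algebra, so that limits of operators stay in the range.\<close>

lemma represents_if_bounded_below:
  assumes E: "csubspace E" "\<And>a x. x \<in> E \<Longrightarrow> m a x \<in> E"
    and "\<kappa> > 0" and lower: "\<And>a. \<kappa> * norm a \<le> (SUP x\<in>unit_ball E. norm (m a x))"
  shows "represents_as_closed_subalgebra m E (\<lambda>a. \<lambda>x\<in>E. m a x)"
proof -
  define \<pi> where "\<pi> = (\<lambda>a. \<lambda>x\<in>E. m a x)"
  have app: "\<pi> a x = m a x" if "x \<in> E" for a x using that by (simp add: \<pi>_def)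
  have plus: "x + y \<in> E" and scale: "c *\<^sub>C x \<in> E" if "x \<in> E" "y \<in> E" for x y c
    using E(1) that by (auto simp: complex_vector.subspace_add complex_vector.subspace_scale)
  have ops: "\<pi> a \<in> bounded_ops E" for a
  proof -
    have "\<pi> a \<in> extensional E" "\<pi> a ` E \<subseteq> E" using E(2) by (auto simp: \<pi>_def)
    moreover have "\<exists>K. \<forall>x\<in>E. norm (\<pi> a x) \<le> K * norm x"
      using norm_product_le[of a] by (auto simp: app)
    ultimately show ?thesis
      by (simp add: bounded_ops_def app plus scale add_right scaleC_right)
  qed
  \<comment> \<open>Membership in \<open>bounded_ops E\<close> selects the supremum branch of
    \<open>op_norm\<close>.\<close>
  have opn: "op_norm E (\<pi> a) = (SUP x\<in>unit_ball E. norm (m a x))" for a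
    unfolding op_norm_def using ops[of a]
    by (auto simp: app unit_ball_def intro!: arg_cong[where f = Sup] image_cong)
  have opn_ge: "\<kappa> * norm a \<le> op_norm E (\<pi> a)" and opn_le: "op_norm E (\<pi> a) \<le> norm a" for a
    unfolding opn using lower SUP_unit_ball_le[OF E(1)] by auto
  have hom_add: "\<pi> (a + b) = op_add E (\<pi> a) (\<pi> b)" for a b
    by (auto simp: \<pi>_def op_add_def add_left restrict_def)
  have hom_scale: "\<pi> (c *\<^sub>C a) = op_scale E c (\<pi> a)" for c a
    by (auto simp: \<pi>_def op_scale_def scaleC_left restrict_def)
  have hom_mult: "\<pi> (m a b) = compose E (\<pi> a) (\<pi> b)" for a b
    using E(2) by (auto simp: \<pi>_def compose_def assoc restrict_def)
  \<comment> \<open>Differences of multiplication operators are again such operators, so the two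
    norm estimates make \<open>\<pi>\<close> bi-Lipschitz.\<close>
  have hom_diff: "(\<lambda>x\<in>E. \<pi> a x - \<pi> b x) = \<pi> (a - b)" for a b
    by (auto simp: \<pi>_def diff_left restrict_def)
  have dist_ge: "\<kappa> * norm (a - b) \<le> op_dist E (\<pi> a) (\<pi> b)" for a b
    unfolding op_dist_def hom_diff by (rule opn_ge)
  have dist_le: "op_dist E (\<pi> a) (\<pi> b) \<le> norm (a - b)" for a b
    unfolding op_dist_def hom_diff by (rule opn_le)
  interpret M: Metric_space "bounded_ops E" "op_dist E"
    by (rule Metric_space_bounded_ops[OF E(1)])
  have rep: "bounded_representation m E \<pi>"
    unfolding bounded_representation_def
    using ops hom_add hom_scale hom_mult opn_le by (auto intro!: exI[of _ 1])
  have inj: "inj \<pi>"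
  proof (rule injI)
    fix a b assume "\<pi> a = \<pi> b"
    then have "\<kappa> * norm (a - b) \<le> 0"
      using dist_ge[of a b] M.mdist_zero[OF ops] by simp
    then show "a = b" using \<open>\<kappa> > 0\<close> by (simp add: mult_le_0_iff)
  qed
  have closed: "closedin M.mtopology (range \<pi>)"
    unfolding M.metric_closedin_iff_sequentially_closed
  proof (intro conjI allI impI)
    show "range \<pi> \<subseteq> bounded_ops E" using ops by blast
    fix \<sigma> T assume \<sigma>: "range \<sigma> \<subseteq> range \<pi> \<and> limitin M.mtopology \<sigma> T sequentially"
    then have "\<forall>i. \<exists>a. \<sigma> i = \<pi> a" by blast
    then obtain u where u: "\<And>i. \<sigma> i = \<pi> (u i)" by metis
    have MC: "M.MCauchy \<sigma>"
      using \<sigma> ops by (intro M.convergent_imp_MCauchy) auto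
    have "Cauchy u"
      unfolding Cauchy_def
    proof (intro allI impI)
      fix e :: real assume "e > 0"
      \<comment> \<open>Pulling distances back along \<open>\<pi>\<close> costs a factor
        \<open>\<kappa>\<close>, so the Cauchy condition is taken at
        \<open>\<kappa> * e\<close>.\<close>
      then have "\<kappa> * e > 0" using \<open>\<kappa> > 0\<close> by simp
      then obtain N where N: "\<And>i j. N \<le> i \<Longrightarrow> N \<le> j \<Longrightarrow> op_dist E (\<sigma> i) (\<sigma> j) < \<kappa> * e"
        using MC unfolding M.MCauchy_def by meson
      have "dist (u i) (u j) < e" if "N \<le> i" "N \<le> j" for i j
        using N[OF that] dist_ge[of "u i" "u j"] \<open>\<kappa> > 0\<close>
        by (simp add: u dist_norm) (metis le_less_trans mult_less_cancel_left_pos)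
      then show "\<exists>N. \<forall>i\<ge>N. \<forall>j\<ge>N. dist (u i) (u j) < e" by blast
    qed
    then obtain a where a: "u \<longlonglongrightarrow> a"
      by (meson Cauchy_convergent convergent_def)
    have "(\<lambda>i. op_dist E (\<sigma> i) (\<pi> a)) \<longlonglongrightarrow> 0"
    proof (rule tendsto_sandwich[OF _ _ tendsto_const])
      show "(\<lambda>i. norm (u i - a)) \<longlonglongrightarrow> 0"
        using a by (simp add: LIM_zero_iff tendsto_norm_zero_iff)
    qed (auto simp: u dist_le)
    then have "limitin M.mtopology \<sigma> (\<pi> a) sequentially"
      using ops by (auto simp: M.limitin_metric_dist_null u)
    then show "T \<in> range \<pi>"
      using \<sigma> M.limitin_metric_unique[of \<sigma> T sequentially "\<pi> a"] by auto
  qed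
  have "(\<lambda>x\<in>E. 0) = \<pi> 0" by (auto simp: \<pi>_def zero_left)
  then have "closed_subalgebra_ops E (range \<pi>)"
    unfolding closed_subalgebra_ops_def
    using ops closed by (auto simp flip: hom_add hom_scale hom_mult)
  then show ?thesis
    using rep inj unfolding represents_as_closed_subalgebra_def \<pi>_def by blast
qed

end

interpretation mult_product: banach_product "(*) :: 'a::complex_banach_algebra \<Rightarrow> 'a \<Rightarrow> 'a"
  by (intro banach_product.intro bounded_bilinear_mult banach_product_axioms.intro)
    (simp_all add: mult_scaleC_left mult_scaleC_right mult.assoc norm_mult_ineq)

interpretation opposite_product: banach_product "opposite_mult :: 'a::complex_banach_algebra \<Rightarrow> 'a \<Rightarrow> 'a"
proof (intro banach_product.intro banach_product_axioms.intro)
  have eq: "opposite_mult = (\<lambda>a b :: 'a::complex_banach_algebra. b * a)" by (simp add: fun_eq_iff opposite_mult_def)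
  show "bounded_bilinear (opposite_mult :: 'a::complex_banach_algebra \<Rightarrow> 'a \<Rightarrow> 'a)"
    unfolding eq by (rule bounded_bilinear.flip[OF bounded_bilinear_mult])
  \<comment> \<open>Here \<open>mult.commute\<close> can swap only the two real norms, as the
    product of the algebra need not commute.\<close>
  show "norm (opposite_mult x y) \<le> norm x * norm y" for x y :: 'a
    unfolding opposite_mult_def using norm_mult_ineq[of y x] by (simp only: mult.commute)
qed (simp_all add: opposite_mult_def mult_scaleC_left mult_scaleC_right mult.assoc)

section \<open>Algebra of the closed ideal powers\<close>

lemma csubspace_closure:
  fixes S :: "'a::complex_banach_algebra set"
  assumes S: "csubspace S"
  shows "csubspace (closure S)"
proof (rule complex_vector.subspaceI)
  show "0 \<in> closure S"
    using complex_vector.subspace_0[OF S] closure_subset by blast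
next
  fix x y assume "x \<in> closure S" "y \<in> closure S"
  then obtain u v where uv: "\<forall>n. u n \<in> S" "u \<longlonglongrightarrow> x" "\<forall>n. v n \<in> S" "v \<longlonglongrightarrow> y"
    unfolding closure_sequential by blast
  have "(\<lambda>n. u n + v n) \<longlonglongrightarrow> x + y" using uv(2,4) by (rule tendsto_add)
  moreover have "\<forall>n. u n + v n \<in> S" using uv(1,3) complex_vector.subspace_add[OF S] by simp
  ultimately show "x + y \<in> closure S"
    unfolding closure_sequential by (intro exI[of _ "\<lambda>n. u n + v n"] conjI)
next
  fix c and x assume "x \<in> closure S"
  \<comment> \<open>Scaling by a fixed complex number is bounded and real-linear, which is enough to
    map the closure of \<open>S\<close> into the closure of its image.\<close>
  moreover have "bounded_linear (\<lambda>x::'a. c *\<^sub>C x)"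
    by (rule bounded_linear_intro[where K = "cmod c"])
      (simp_all add: scaleC_add_right scaleR_scaleC scaleC_scaleC norm_scaleC mult.commute)
  ultimately have "c *\<^sub>C x \<in> closure ((\<lambda>x. c *\<^sub>C x) ` S)"
    using closure_bounded_linear_image_subset by blast
  moreover have "(\<lambda>x. c *\<^sub>C x) ` S \<subseteq> S"
    using complex_vector.subspace_scale[OF S] by blast
  ultimately show "c *\<^sub>C x \<in> closure S"
    using closure_mono by blast
qed

lemma csubspace_ideal_power: "csubspace (ideal_power J n)"
  unfolding ideal_power_def
  by (intro csubspace_closure complex_vector.subspace_span)

lemma foldl_mult_in_ideal_power:
  assumes "set (x # xs) \<subseteq> J"
  shows "foldl (*) x xs \<in> ideal_power J (Suc (length xs))"
  unfolding ideal_power_def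
  by (rule subsetD[OF closure_subset], rule complex_vector.span_base) (use assms in auto)

text \<open>The preimage of \<open>ideal_power J k\<close> under \<open>f\<close> is a closed
  subspace, so it contains \<open>ideal_power J n\<close> once it contains the n-fold products. The
  one-sided multiplications below are instances.\<close>

lemma ideal_power_image:
  fixes f :: "'a::complex_banach_algebra \<Rightarrow> 'a"
  assumes f: "bounded_linear f" "\<And>c x. f (c *\<^sub>C x) = c *\<^sub>C f x"
    and gen: "\<And>x xs. set (x # xs) \<subseteq> J \<Longrightarrow> Suc (length xs) = n
      \<Longrightarrow> f (foldl (*) x xs) \<in> ideal_power J k"
    and y: "y \<in> ideal_power J n"
  shows "f y \<in> ideal_power J k"
proof -
  interpret bounded_linear f by (rule f(1))
  let ?V = "f -` ideal_power J k"
  have "csubspace ?V"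
    by (rule complex_vector.subspaceI)
      (use csubspace_ideal_power[of J k] in \<open>auto simp: zero add f(2)
        complex_vector.subspace_0 complex_vector.subspace_add complex_vector.subspace_scale\<close>)
  moreover have "closed ?V"
    unfolding ideal_power_def
    by (intro closed_vimage closed_closure linear_continuous_on f(1))
  ultimately have "ideal_power J n \<subseteq> ?V"
    unfolding ideal_power_def[of J n]
    by (intro closure_minimal complex_vector.span_minimal) (use gen in auto)
  then show ?thesis using y by blast
qed

lemma foldl_mult_left:
  fixes a :: "'a::semigroup_mult"
  shows "a * foldl (*) x xs = foldl (*) (a * x) xs"
  by (induction xs arbitrary: x) (simp_all flip: mult.assoc)

text \<open>The extra factor is absorbed into the first entry of each product.\<close>

lemma ideal_power_left_ideal:
  assumes "left_ideal J" "y \<in> ideal_power J n"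
  shows "a * y \<in> ideal_power J n"
proof (rule ideal_power_image[of "(*) a", OF _ _ _ assms(2)])
  fix x xs assume "set (x # xs) \<subseteq> J" "Suc (length xs) = n"
  then show "a * foldl (*) x xs \<in> ideal_power J n"
    using assms(1) foldl_mult_in_ideal_power[of "a * x" xs J]
    by (auto simp: foldl_mult_left left_ideal_def)
qed (simp_all add: bounded_linear_mult_right mult_scaleC_right)

lemma ideal_power_right_ideal:
  assumes "right_ideal J" "y \<in> ideal_power J n"
  shows "y * a \<in> ideal_power J n"
proof (rule ideal_power_image[of "\<lambda>y. y * a", OF _ _ _ assms(2)])
  fix x xs assume *: "set (x # xs) \<subseteq> J" "Suc (length xs) = n"
  show "foldl (*) x xs * a \<in> ideal_power J n"
  \<comment> \<open>The factor on the right is absorbed into the last entry, which is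
    \<open>x\<close> itself when \<open>xs\<close> is empty.\<close>
  proof (cases xs rule: rev_cases)
    case Nil
    then show ?thesis
      using assms(1) * foldl_mult_in_ideal_power[of "x * a" "[]" J] by (auto simp: right_ideal_def)
  next
    case (snoc ys z)
    then show ?thesis
      using assms(1) * foldl_mult_in_ideal_power[of x "ys @ [z * a]" J]
      by (auto simp: right_ideal_def mult.assoc)
  qed
qed (simp_all add: bounded_linear_mult_left mult_scaleC_left)

lemma ideal_power_Suc_left:
  assumes "x \<in> J" "y \<in> ideal_power J n"
  shows "x * y \<in> ideal_power J (Suc n)"
proof (rule ideal_power_image[of "(*) x", OF _ _ _ assms(2)])
  fix z zs assume "set (z # zs) \<subseteq> J" "Suc (length zs) = n"
  then show "x * foldl (*) z zs \<in> ideal_power J (Suc n)"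
    using assms(1) foldl_mult_in_ideal_power[of x "z # zs" J] by (auto simp: foldl_mult_left)
qed (simp_all add: bounded_linear_mult_right mult_scaleC_right)

lemma ideal_power_Suc_right:
  assumes "x \<in> J" "y \<in> ideal_power J n"
  shows "y * x \<in> ideal_power J (Suc n)"
proof (rule ideal_power_image[of "\<lambda>y. y * x", OF _ _ _ assms(2)])
  fix z zs assume "set (z # zs) \<subseteq> J" "Suc (length zs) = n"
  then show "foldl (*) z zs * x \<in> ideal_power J (Suc n)"
    using assms(1) foldl_mult_in_ideal_power[of z "zs @ [x]" J] by auto
qed (simp_all add: bounded_linear_mult_left mult_scaleC_left)

text \<open>Span and closure fix a closed subspace. This puts the bounds assumed for
  \<open>J\<close> into the form of the base case of the induction.\<close>

lemma ideal_power_1: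
  assumes "csubspace J" "closed J"
  shows "ideal_power J 1 = J"
proof -
  have gen: "{foldl (*) x xs | x xs. set (x # xs) \<subseteq> J \<and> length (x # xs) = 1} = J"
    by (force simp: intro: exI[of _ "[]"])
  have span: "cspan J = J"
    using assms(1) by (rule complex_vector.span_eq_iff[THEN iffD2])
  show ?thesis
    unfolding ideal_power_def gen span using assms(2) by (rule closure_closed)
qed

theorem theorem7p1:
  fixes J :: "'a::complex_banach_algebra set" and \<kappa>\<^sub>r \<kappa>\<^sub>l :: real
  assumes "closed_two_sided_ideal J"
    and "\<kappa>\<^sub>r > 0" and "\<kappa>\<^sub>l > 0"
    and "\<And>a :: 'a. \<kappa>\<^sub>r * norm a \<le> (SUP x\<in>unit_ball J. norm (a * x))"
    and "\<And>a :: 'a. \<kappa>\<^sub>l * norm a \<le> (SUP x\<in>unit_ball J. norm (x * a))"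
  shows
    "(\<forall>n\<ge>1.
        (\<forall>a :: 'a.
           \<kappa>\<^sub>r ^ n * norm a \<le> (SUP x\<in>unit_ball (ideal_power J n). norm (a * x)) \<and>
           (SUP x\<in>unit_ball (ideal_power J n). norm (a * x)) \<le> norm a \<and>
           \<kappa>\<^sub>l ^ n * norm a \<le> (SUP x\<in>unit_ball (ideal_power J n). norm (x * a)) \<and>
           (SUP x\<in>unit_ball (ideal_power J n). norm (x * a)) \<le> norm a) \<and>
        essential_on_both_sides (ideal_power J n) \<and>
        represents_as_closed_subalgebra (*) (ideal_power J n) (left_mult_on (ideal_power J n)) \<and>
        represents_as_closed_subalgebra opposite_mult (ideal_power J n)
          (right_mult_on (ideal_power J n))) \<and>
     (\<forall>n\<ge>1. \<forall>(\<Phi> :: 'a \<Rightarrow> 'b::complex_banach_algebra) \<eta>.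
        bounded_algebra_hom \<Phi> \<and> \<eta> > 0 \<and>
        (\<forall>x\<in>ideal_power J n. norm (\<Phi> x) \<ge> \<eta> * norm x) \<and>
        (UNIV :: 'a set) \<noteq> {0} \<longrightarrow>
        (\<forall>a. norm (\<Phi> a) \<ge> \<eta> * \<kappa>\<^sub>r ^ n / onorm \<Phi> * norm a))"
proof -
  have J: "left_ideal J" "right_ideal J" "csubspace J" "closed J"
    using assms(1) by (auto simp: closed_two_sided_ideal_def left_ideal_def)
  note J1 = ideal_power_1[OF J(3,4)]
  note sub = csubspace_ideal_power[of J]
  \<comment> \<open>In \<open>J1[simplified]\<close> the exponent 1 becomes \<open>Suc 0\<close>,
    the form it takes in the simplified goals.\<close>
  have L: "\<kappa>\<^sub>r ^ n * norm a \<le> (SUP x\<in>unit_ball (ideal_power J n). norm (a * x))"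
    if "n \<ge> 1" for n a
    by (rule mult_product.power_lower_bound[OF sub _ \<open>\<kappa>\<^sub>r > 0\<close> _ that])
      (use assms(4) ideal_power_Suc_left in \<open>auto simp: J1[simplified]\<close>)
  have R: "\<kappa>\<^sub>l ^ n * norm a \<le> (SUP x\<in>unit_ball (ideal_power J n). norm (opposite_mult a x))"
    if "n \<ge> 1" for n a
    by (rule opposite_product.power_lower_bound[OF sub _ \<open>\<kappa>\<^sub>l > 0\<close> _ that])
      (use assms(5) ideal_power_Suc_right in \<open>auto simp: J1[simplified] opposite_mult_def\<close>)
  have left: "a * x \<in> ideal_power J n" and right: "opposite_mult a x \<in> ideal_power J n"
    if "x \<in> ideal_power J n" for a x n
    using that ideal_power_left_ideal[OF J(1)] ideal_power_right_ideal[OF J(2)]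
    by (auto simp: opposite_mult_def)
  have pos: "\<kappa>\<^sub>r ^ n > 0" "\<kappa>\<^sub>l ^ n > 0" for n using assms(2,3) by auto
  have ess: "essential_on_both_sides (ideal_power J n)" if "n \<ge> 1" for n
    unfolding essential_on_both_sides_def
  proof (intro conjI allI impI)
    fix I :: "'a set" assume "right_ideal I \<and> I \<noteq> {0}"
    then show "I \<inter> ideal_power J n \<noteq> {0}"
      by (intro mult_product.essential_if_bounded_below[OF sub left pos(1) L[OF that]])
        (auto simp: right_ideal_def)
  next
    \<comment> \<open>For the opposite product a left ideal is a right ideal, so the same lemma
      applies.\<close>
    fix I :: "'a set" assume "left_ideal I \<and> I \<noteq> {0}"
    then show "I \<inter> ideal_power J n \<noteq> {0}"
      by (intro opposite_product.essential_if_bounded_below[OF sub right pos(2) R[OF that]])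
        (auto simp: left_ideal_def opposite_mult_def)
  qed
  have repL: "represents_as_closed_subalgebra (*) (ideal_power J n)
      (left_mult_on (ideal_power J n))" if "n \<ge> 1" for n
    using mult_product.represents_if_bounded_below[OF sub left pos(1) L[OF that]]
    unfolding left_mult_on_def[abs_def] .
  \<comment> \<open>Unfolding affects \<open>opposite_mult\<close> only where it is applied to two
    arguments; as the product being represented it stays.\<close>
  have repR: "represents_as_closed_subalgebra opposite_mult (ideal_power J n)
      (right_mult_on (ideal_power J n))" if "n \<ge> 1" for n
    using opposite_product.represents_if_bounded_below[OF sub right pos(2) R[OF that]]
    unfolding right_mult_on_def[abs_def] opposite_mult_def .
  have hom: "norm (\<Phi> a) \<ge> \<eta> * \<kappa>\<^sub>r ^ n / onorm \<Phi> * norm a"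
    if n: "n \<ge> 1" and \<Phi>: "bounded_algebra_hom \<Phi>" and "\<eta> > 0"
      and below: "\<forall>x\<in>ideal_power J n. norm (\<Phi> x) \<ge> \<eta> * norm x"
    for n a \<eta> and \<Phi> :: "'a \<Rightarrow> 'b"
  proof -
    have bl: "bounded_linear \<Phi>" and mult: "\<And>a b. \<Phi> (a * b) = \<Phi> a * \<Phi> b"
      using \<Phi> by (auto simp: bounded_algebra_hom_def)
    \<comment> \<open>The product \<open>a * x\<close> lies in the ideal power even when
      \<open>a\<close> does not, so \<open>below\<close> applies to it.\<close>
    have "norm (a * x) \<le> onorm \<Phi> * norm (\<Phi> a) / \<eta>" if x: "x \<in> unit_ball (ideal_power J n)" for x
    proof -
      have "\<eta> * norm (a * x) \<le> norm (\<Phi> a * \<Phi> x)"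
        using below left[of x n a] x by (auto simp: unit_ball_def simp flip: mult)
      also have "\<dots> \<le> norm (\<Phi> a) * norm (\<Phi> x)" by (rule norm_mult_ineq)
      also have "\<dots> \<le> norm (\<Phi> a) * (onorm \<Phi> * norm x)"
        by (intro mult_left_mono onorm[OF bl]) auto
      also have "\<dots> \<le> norm (\<Phi> a) * (onorm \<Phi> * 1)"
        using x by (intro mult_left_mono onorm_pos_le[OF bl]) (auto simp: unit_ball_def)
      finally show ?thesis using \<open>\<eta> > 0\<close> by (simp add: field_simps)
    qed
    then have "(SUP x\<in>unit_ball (ideal_power J n). norm (a * x)) \<le> onorm \<Phi> * norm (\<Phi> a) / \<eta>"
      using zero_in_unit_ball[OF sub] by (intro cSUP_least) auto
    with L[OF n, of a] have "\<kappa>\<^sub>r ^ n * norm a \<le> onorm \<Phi> * norm (\<Phi> a) / \<eta>" by linarith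
    then show ?thesis
      \<comment> \<open>if \<open>onorm \<Phi> = 0\<close>, the right-hand side is \<open>0\<close> because \<open>x / 0 = 0\<close>\<close>
      using \<open>\<eta> > 0\<close> onorm_pos_le[OF bl] by (cases "onorm \<Phi> = 0") (simp_all add: field_simps)
  qed
  show ?thesis
    using L R[unfolded opposite_mult_def] mult_product.SUP_unit_ball_le[OF sub]
      opposite_product.SUP_unit_ball_le[OF sub, unfolded opposite_mult_def] ess repL repR hom
    by blast
qed

end
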